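(* Let $X$ be a real Banach space, $K\subseteq X^*$ a convex weak*-compact subset and $H\subseteq K$ a set which $(I)$-generates $K$. Let $I$ be an ideal on $\mathbb{N}$ such that the filter $\mathcal{F}(I)$ has a countable base. Let $S$ be a non-empty set and let $\mathcal{B}=(B_i)_{i\in S}$, $B_i=(b_{nk}^{(i)})_{n,k\in\mathbb{N}}$, be a family of infinite matrices with non-negative real entries such that $\inf_{n\in\mathbb{N}}\sum_{k=1}^{\infty}b_{nk}^{(i_0)}>0$ for some $i_0\in S$. Assume that there exists $A\in I$ such that $$\sup\left\{\sum_{k=1}^{\infty}b_{nk}^{(i)}: n\in\mathbb{N}\setminus A,\ i\in S\right\}<\infty .$$ Let $(x_n)_{n\in\mathbb{N}}$ be a bounded sequence in $X$. Then $$\sup_{x^*\in H} J_{\mathcal{B},I}\text{-}\limsup x^*(x_n)=\sup_{x^*\in K} J_{\mathcal{B},I}\text{-}\limsup x^*(x_n).$$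
   Context: An ideal $I$ on $\mathbb{N}$ is a non-empty set of subsets of $\mathbb{N}$ with $\mathbb{N}\notin I$, closed under subsets and finite unions; $\mathcal{F}(I)=\{\mathbb{N}\setminus A: A\in I\}$ is the associated filter. A countable base of $\mathcal{F}(I)$ is a countable family $\mathcal{W}\subseteq\mathcal{F}(I)$ such that every element of $\mathcal{F}(I)$ contains an element of $\mathcal{W}$. For a family $\mathcal{B}$ as in the claim, $J_{\mathcal{B},I}$ is the set of all $D\subseteq\mathbb{N}$ such that for every $\varepsilon>0$ we have $\{n\in\mathbb{N}:\sup_{i\in S}\sum_{k=1}^{\infty}b_{nk}^{(i)}\chi_D(k)\geq\varepsilon\}\in I$ (sums are taken in $[0,\infty]$; $\chi_D$ is the characteristic function of $D$). It is an ideal on $\mathbb{N}$. For an ideal $J$ on $\mathbb{N}$ and a real sequence $(s_n)$, $J\text{-}\limsup s_n=\sup\{t\in\mathbb{R}:\{n\in\mathbb{N}: s_n>t\}\notin J\}$. For a convex weak*-compact set $K\subseteq X^*$, a subset $H\subseteq K$ is said to $(I)$-generate $K$ (here "$(I)$" is just part of the name and is unrelated to the ideal $I$) if whenever $H=\bigcup_{m=1}^{\infty}H_m$ is a countable union with $H_m\subseteq H_{m+1}$ for all $m$, then $K$ equals the norm-closure of $\bigcup_{m=1}^{\infty}\overline{\mathrm{co}}^{w^*}H_m$, where $\overline{\mathrm{co}}^{w^*}$ denotes the weak*-closed convex hull. *)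

theory Defs
  imports "HOL-Analysis.Analysis"
begin

definition nat_ideal :: "nat set set \<Rightarrow> bool" where
  "nat_ideal I \<longleftrightarrow> I \<noteq> {} \<and> UNIV \<notin> I \<and>
     (\<forall>A\<in>I. \<forall>B. B \<subseteq> A \<longrightarrow> B \<in> I) \<and> (\<forall>A\<in>I. \<forall>B\<in>I. A \<union> B \<in> I)"

definition assoc_filter :: "nat set set \<Rightarrow> nat set set" where
  "assoc_filter I = {- A |A. A \<in> I}"

definition has_countable_base :: "nat set set \<Rightarrow> bool" where
  "has_countable_base F \<longleftrightarrow> (\<exists>W. countable W \<and> W \<subseteq> F \<and> (\<forall>A\<in>F. \<exists>B\<in>W. B \<subseteq> A))"

text \<open>
  The series and suprema below are taken in \<^typ>\<open>ennreal\<close>. Since \<^const>\<open>ennreal\<close> sends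
  negative reals to \<open>0\<close>, the definition is only meaningful for non-negative entries \<open>b i n k\<close>.
  The row index \<open>n\<close> and the column index \<open>k\<close> start at \<open>0\<close>.
\<close>
definition matrix_ideal ::
    "'i set \<Rightarrow> ('i \<Rightarrow> nat \<Rightarrow> nat \<Rightarrow> real) \<Rightarrow> nat set set \<Rightarrow> nat set set" where
  "matrix_ideal S b I =
     {D. \<forall>\<epsilon>::real. \<epsilon> > 0 \<longrightarrow>
        {n. (SUP i\<in>S. \<Sum>k. ennreal (b i n k * indicat_real D k)) \<ge> ennreal \<epsilon>} \<in> I}"

text \<open>The value lies in \<^typ>\<open>ereal\<close>, so that unbounded sequences and empty sets of
  thresholds need no special treatment.\<close>
definition ideal_limsup :: "nat set set \<Rightarrow> (nat \<Rightarrow> real) \<Rightarrow> ereal" where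
  "ideal_limsup J s = Sup {ereal t |t. {n. s n > t} \<notin> J}"

text \<open>On the dual space \<open>'a \<Rightarrow>\<^sub>L real\<close>, the topology of pointwise convergence on \<open>'a\<close>
  is the weak* topology.\<close>
abbreviation weak_star_topology :: "('a::real_normed_vector \<Rightarrow>\<^sub>L real) topology" where
  "weak_star_topology \<equiv> strong_operator_topology"

definition I_generates ::
    "('a::real_normed_vector \<Rightarrow>\<^sub>L real) set \<Rightarrow> ('a \<Rightarrow>\<^sub>L real) set \<Rightarrow> bool" where
  "I_generates H K \<longleftrightarrow>
     (\<forall>Hm :: nat \<Rightarrow> ('a \<Rightarrow>\<^sub>L real) set.
        (\<forall>m. Hm m \<subseteq> Hm (Suc m)) \<longrightarrow> H = (\<Union>m. Hm m) \<longrightarrow>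
        K = closure (\<Union>m. weak_star_topology closure_of (convex hull (Hm m))))"

end

theory Submission
  imports Defs
begin

text \<open>
  Let \<open>t\<close> exceed the supremum over \<open>H\<close> and fix \<open>\<epsilon> > 0\<close>. Along a decreasing base
  \<open>V\<^sub>0 \<supseteq> V\<^sub>1 \<supseteq> \<dots>\<close> of the filter, let \<open>H\<^sub>m\<close> be the set of those \<open>f \<in> H\<close> for which
  \<open>\<Sum>\<^sub>k b\<^sub>n\<^sub>k (f (x\<^sub>k) - t)\<^sup>+ \<le> \<epsilon>\<close> for all \<open>n \<in> V\<^sub>m\<close> and all matrices of the family. Boundedness
  of the sequence shows that the \<open>H\<^sub>m\<close> exhaust \<open>H\<close>. The defining condition is convex and
  weak* closed in \<open>f\<close>, so it passes to the weak* closed convex hulls; because the row sums are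
  bounded it passes, with a slightly larger \<open>\<epsilon>\<close>, to the norm closure of their union, which is
  \<open>K\<close>. Markov's inequality then gives \<open>{k. f (x\<^sub>k) > s} \<in> J\<close> for all \<open>f \<in> K\<close> and \<open>s > t\<close>.
\<close>

section \<open>Membership in the matrix ideal through finite partial sums\<close>

lemma SUP_suminf_ennreal_le_iff:
  fixes c :: "'i \<Rightarrow> nat \<Rightarrow> real"
  assumes nonneg: "\<And>i k. i \<in> S \<Longrightarrow> c i k \<ge> 0" and e: "e \<ge> 0"
  shows "(SUP i\<in>S. \<Sum>k. ennreal (c i k)) \<le> ennreal e \<longleftrightarrow> (\<forall>i\<in>S. \<forall>N. (\<Sum>k<N. c i k) \<le> e)"
proof -
  have "(\<Sum>k. ennreal (c i k)) \<le> ennreal e \<longleftrightarrow> (\<forall>N. (\<Sum>k<N. c i k) \<le> e)" if "i \<in> S" for i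
  proof -
    have "(\<Sum>k. ennreal (c i k)) = (SUP N. ennreal (\<Sum>k<N. c i k))"
      using nonneg[OF that] by (simp add: suminf_eq_SUP sum_ennreal)
    then show ?thesis
      using e by (simp add: SUP_le_iff)
  qed
  then show ?thesis
    by (simp add: SUP_le_iff)
qed

text \<open>The sets with \<ge> in the definition and the bounds with \<le> here give the same ideal
  because \<epsilon> is arbitrary: the converse direction inserts \<open>\<epsilon> / 2\<close>.
  Finite real sums replace the \<open>ennreal\<close> series so that continuity and convexity in the
  functional can be used.\<close>

lemma mem_matrix_ideal_iff:
  assumes I: "nat_ideal I" and nonneg: "\<And>i n k. i \<in> S \<Longrightarrow> b i n k \<ge> 0"
  shows "D \<in> matrix_ideal S b I \<longleftrightarrow>
    (\<forall>\<epsilon>>0. \<exists>A\<in>I. \<forall>n\<in>- A. \<forall>i\<in>S. \<forall>N. (\<Sum>k<N. b i n k * indicat_real D k) \<le> \<epsilon>)"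
    (is "_ \<longleftrightarrow> (\<forall>\<epsilon>>0. \<exists>A\<in>I. \<forall>n\<in>- A. ?small \<epsilon> n)")
proof -
  define r where "r n = (SUP i\<in>S. \<Sum>k. ennreal (b i n k * indicat_real D k))" for n
  have r_le: "r n \<le> ennreal \<epsilon> \<longleftrightarrow> ?small \<epsilon> n" if "\<epsilon> > 0" for n \<epsilon>
    unfolding r_def using that nonneg by (intro SUP_suminf_ennreal_le_iff) auto
  have D: "D \<in> matrix_ideal S b I \<longleftrightarrow> (\<forall>\<epsilon>>0. {n. r n \<ge> ennreal \<epsilon>} \<in> I)"
    by (simp add: matrix_ideal_def r_def)
  show ?thesis
  proof (intro iffI allI impI)
    fix \<epsilon> :: real
    assume "D \<in> matrix_ideal S b I" "\<epsilon> > 0"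
    then have "{n. r n \<ge> ennreal \<epsilon>} \<in> I"
      using D by blast
    moreover have "\<forall>n\<in>- {n. r n \<ge> ennreal \<epsilon>}. ?small \<epsilon> n"
      using r_le[OF \<open>\<epsilon> > 0\<close>] by (auto simp: not_le dest!: less_imp_le)
    ultimately show "\<exists>A\<in>I. \<forall>n\<in>- A. ?small \<epsilon> n"
      by blast
  next
    assume *: "\<forall>\<epsilon>>0. \<exists>A\<in>I. \<forall>n\<in>- A. ?small \<epsilon> n"
    have "{n. r n \<ge> ennreal \<epsilon>} \<in> I" if "\<epsilon> > 0" for \<epsilon>
    proof -
      have half: "\<epsilon> / 2 > 0"
        using that by simp
      then obtain A where A: "A \<in> I" "\<forall>n\<in>- A. ?small (\<epsilon> / 2) n"
        using * by blast
      have "r n < ennreal \<epsilon>" if "n \<notin> A" for n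
      proof -
        have "r n \<le> ennreal (\<epsilon> / 2)"
          using A(2) r_le[OF half] that by blast
        also have "\<dots> < ennreal \<epsilon>"
          using \<open>\<epsilon> > 0\<close> by (simp add: ennreal_lessI)
        finally show ?thesis .
      qed
      then have "{n. r n \<ge> ennreal \<epsilon>} \<subseteq> A"
        using linorder_not_less by blast
      then show ?thesis
        using I A(1) unfolding nat_ideal_def by blast
    qed
    then show "D \<in> matrix_ideal S b I"
      using D by blast
  qed
qed

section \<open>Decreasing bases of the filter\<close>

lemma assoc_filter_UNIV: "nat_ideal I \<Longrightarrow> UNIV \<in> assoc_filter I"
  unfolding nat_ideal_def assoc_filter_def by (blast intro: Compl_empty_eq[symmetric])

lemma assoc_filter_Int:
  "nat_ideal I \<Longrightarrow> U \<in> assoc_filter I \<Longrightarrow> V \<in> assoc_filter I \<Longrightarrow> U \<inter> V \<in> assoc_filter I"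
  unfolding nat_ideal_def assoc_filter_def mem_Collect_eq by (metis Compl_Un)

text \<open>Intersecting the first members of an enumeration of the base makes it decreasing. The
  base is non-empty since the filter contains \<open>UNIV\<close>, so \<open>from_nat_into\<close>
  stays inside it and reaches each member, with repetitions if it is finite.\<close>

lemma has_countable_base_decseq:
  assumes I: "nat_ideal I" and base: "has_countable_base (assoc_filter I)"
  obtains V :: "nat \<Rightarrow> nat set" where "decseq V" "\<And>m. V m \<in> assoc_filter I"
    "\<And>U. U \<in> assoc_filter I \<Longrightarrow> \<exists>m. V m \<subseteq> U"
proof -
  obtain W where W: "countable W" "W \<subseteq> assoc_filter I" "\<forall>U\<in>assoc_filter I. \<exists>B\<in>W. B \<subseteq> U"
    using base unfolding has_countable_base_def by blast
  then have "W \<noteq> {}"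
    using assoc_filter_UNIV[OF I] by blast
  define V where "V m = (\<Inter>j\<le>m. from_nat_into W j)" for m
  show ?thesis
  proof
    show "decseq V"
      unfolding decseq_def V_def by (auto intro: order_trans)
    have W_filter: "from_nat_into W j \<in> assoc_filter I" for j
      using W(2) from_nat_into[OF \<open>W \<noteq> {}\<close>] by blast
    show "V m \<in> assoc_filter I" for m
      by (induction m) (auto simp: V_def atMost_Suc W_filter intro: assoc_filter_Int[OF I])
    show "\<exists>m. V m \<subseteq> U" if "U \<in> assoc_filter I" for U
    proof -
      obtain B where B: "B \<in> W" "B \<subseteq> U"
        using W(3) \<open>U \<in> assoc_filter I\<close> by blast
      obtain m where "from_nat_into W m = B"
        using from_nat_into_surj[OF W(1) B(1)] by blast
      moreover have "V m \<subseteq> from_nat_into W m"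
        by (auto simp: V_def)
      ultimately show ?thesis
        using B(2) by (intro exI[of _ m]) simp
    qed
  qed
qed

section \<open>Sublevel sets of finite excess sums\<close>

lemma closedin_excess_sum_le:
  fixes x :: "nat \<Rightarrow> 'a::real_normed_vector"
  shows "closedin weak_star_topology
    {f. (\<Sum>k<N. c k * max 0 (blinfun_apply f (x k) - t)) \<le> \<epsilon>}"
proof -
  \<comment> \<open>A finite sum involves only finitely many point evaluations, each of them weak*
    continuous.\<close>
  have "continuous_map weak_star_topology euclideanreal
      (\<lambda>f. \<Sum>k<N. c k * max 0 (blinfun_apply f (x k) - t))"
    by (intro continuous_intros strong_operator_topology_continuous_evaluation) auto
  from closedin_continuous_map_preimage[OF this, of "{..\<epsilon>}"] show ?thesis
    by (simp add: strong_operator_topology_topspace)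
qed

text \<open>The positive part of an affine function of \<open>f\<close> is convex, and non-negative
  weights preserve this. The indicator of \<open>f (x k) > t\<close> lacks this convexity, hence the
  use of the excess.\<close>

lemma convex_excess_sum_le:
  fixes x :: "nat \<Rightarrow> 'a::real_normed_vector" and c :: "nat \<Rightarrow> real"
  assumes "\<And>k. c k \<ge> 0"
  shows "convex {f. (\<Sum>k<N. c k * max 0 (blinfun_apply f (x k) - t)) \<le> \<epsilon>}"
    (is "convex {f. ?F f \<le> \<epsilon>}")
proof -
  have "convex_on UNIV (\<lambda>f. max 0 (blinfun_apply f y - t))" for y :: 'a
  proof (rule convex_onI)
    fix u :: real and f g :: "'a \<Rightarrow>\<^sub>L real"
    assume u: "0 < u" "u < 1"
    have "blinfun_apply ((1 - u) *\<^sub>R f + u *\<^sub>R g) y - t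
        = (1 - u) * (blinfun_apply f y - t) + u * (blinfun_apply g y - t)"
      by (simp add: blinfun.bilinear_simps algebra_simps)
    also have "\<dots> \<le> (1 - u) * max 0 (blinfun_apply f y - t) + u * max 0 (blinfun_apply g y - t)"
      using u by (intro add_mono mult_left_mono) auto
    finally show "max 0 (blinfun_apply ((1 - u) *\<^sub>R f + u *\<^sub>R g) y - t)
        \<le> (1 - u) * max 0 (blinfun_apply f y - t) + u * max 0 (blinfun_apply g y - t)"
      using u by simp
  qed simp
  then have conv: "convex_on UNIV (\<lambda>f. \<Sum>k<N. c k * max 0 (blinfun_apply f (x k) - t))"
    using assms by (induction N) (auto simp: convex_on_const intro!: convex_on_add convex_on_cmul)
  show ?thesis
  proof (rule convexI, unfold mem_Collect_eq)
    fix f g :: "'a \<Rightarrow>\<^sub>L real" and u v :: real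
    assume f: "?F f \<le> \<epsilon>" and g: "?F g \<le> \<epsilon>" and uv: "0 \<le> u" "0 \<le> v" "u + v = 1"
    have "?F (u *\<^sub>R f + v *\<^sub>R g) \<le> u * ?F f + v * ?F g"
      using conv uv unfolding convex_on_def by blast
    also have "\<dots> \<le> \<epsilon>"
      using f g uv by (rule convex_bound_le)
    finally show "?F (u *\<^sub>R f + v *\<^sub>R g) \<le> \<epsilon>" .
  qed
qed

section \<open>Transfer of small superlevel sets from the generating set to \<open>K\<close>\<close>

lemma generated_superlevel_mem_matrix_ideal:
  fixes K H :: "('a::real_normed_vector \<Rightarrow>\<^sub>L real) set"
  assumes gen: "I_generates H K"
    and I: "nat_ideal I"
    and base: "has_countable_base (assoc_filter I)"
    and nonneg: "\<And>i n k. i \<in> S \<Longrightarrow> b i n k \<ge> 0"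
    and rows: "A \<in> I" "\<And>n i N. n \<notin> A \<Longrightarrow> i \<in> S \<Longrightarrow> (\<Sum>k<N. b i n k) \<le> M"
    and bnd: "bounded (range x)"
    and H: "\<And>f. f \<in> H \<Longrightarrow> {n. blinfun_apply f (x n) > t} \<in> matrix_ideal S b I"
    and g: "g \<in> K" and "s > t"
  shows "{n. blinfun_apply g (x n) > s} \<in> matrix_ideal S b I"
proof -
  obtain V :: "nat \<Rightarrow> nat set" where V: "decseq V" "\<And>m. V m \<in> assoc_filter I"
    "\<And>U. U \<in> assoc_filter I \<Longrightarrow> \<exists>m. V m \<subseteq> U"
    using has_countable_base_decseq[OF I base] by blast
  obtain C where C: "C > 0" "\<And>n. norm (x n) \<le> C"
    using bnd by (auto simp: bounded_pos)
  define E where "E i n N f = (\<Sum>k<N. b i n k * max 0 (blinfun_apply f (x k) - t))" for i n N f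
  define P where "P \<epsilon> m = {f. \<forall>n\<in>V m. \<forall>i\<in>S. \<forall>N. E i n N f \<le> \<epsilon>}" for \<epsilon> m
  have mem_iff: "D \<in> matrix_ideal S b I \<longleftrightarrow>
      (\<forall>\<epsilon>>0. \<exists>A\<in>I. \<forall>n\<in>- A. \<forall>i\<in>S. \<forall>N. (\<Sum>k<N. b i n k * indicat_real D k) \<le> \<epsilon>)" for D
    using I nonneg by (rule mem_matrix_ideal_iff)
  have P_eq: "P \<epsilon> m = (\<Inter>n\<in>V m. \<Inter>i\<in>S. \<Inter>N. {f. E i n N f \<le> \<epsilon>})" for \<epsilon> m
    by (auto simp: P_def)
  have P_mono: "P \<epsilon> m \<subseteq> P \<epsilon> (Suc m)" for \<epsilon> m
    using decseqD[OF V(1), of m "Suc m"] by (auto simp: P_def)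
  have P_convex: "convex (P \<epsilon> m)" for \<epsilon> m
    unfolding P_eq E_def by (intro convex_INT convex_excess_sum_le nonneg)
  have P_closed: "closedin weak_star_topology (P \<epsilon> m)" for \<epsilon> m
  proof -
    \<comment> \<open>Inserting \<open>UNIV\<close> keeps the intersected family non-empty, as
      \<open>closedin_Inter\<close> requires.\<close>
    have P_Inter: "P \<epsilon> m = \<Inter> (insert UNIV {{f. E i n N f \<le> \<epsilon>} |i n N. n \<in> V m \<and> i \<in> S})"
      by (auto simp: P_def)
    have UNIV: "closedin weak_star_topology (UNIV :: ('a \<Rightarrow>\<^sub>L real) set)"
      by (metis closedin_topspace strong_operator_topology_topspace)
    have sublevel: "closedin weak_star_topology {f. E i n N f \<le> \<epsilon>}" for i n N
      unfolding E_def by (rule closedin_excess_sum_le)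
    show ?thesis
      unfolding P_Inter
    proof (rule closedin_Inter)
      fix F
      assume "F \<in> insert UNIV {{f. E i n N f \<le> \<epsilon>} |i n N. n \<in> V m \<and> i \<in> S}"
      then consider "F = UNIV" | i n N where "F = {f. E i n N f \<le> \<epsilon>}"
        by blast
      then show "closedin weak_star_topology F"
        using UNIV sublevel by cases simp_all
    qed simp
  qed
  have exhaust: "\<exists>m. f \<in> P \<epsilon> m" if f: "f \<in> H" and "\<epsilon> > 0" for f \<epsilon>
  proof -
    \<comment> \<open>\<open>R\<close> bounds the excess \<open>f (x k) - t\<close> wherever it is
      positive; the summand 1 makes \<open>R\<close> positive, so that \<epsilon> can be divided by
      it.\<close>
    define R where "R = norm f * C + \<bar>t\<bar> + 1"
    have "R > 0"
      using C(1) by (simp add: R_def add_nonneg_pos)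
    have excess: "max 0 (blinfun_apply f (x k) - t)
        \<le> R * indicat_real {n. blinfun_apply f (x n) > t} k" for k
    proof -
      have "norm (blinfun_apply f (x k)) \<le> norm f * C"
        using norm_blinfun[of f "x k"] C(2)[of k] by (meson mult_left_mono norm_ge_zero order_trans)
      then show ?thesis
        using \<open>R > 0\<close> by (auto simp: indicator_def R_def)
    qed
    obtain B where B: "B \<in> I" "\<forall>n\<in>- B. \<forall>i\<in>S. \<forall>N.
        (\<Sum>k<N. b i n k * indicat_real {n. blinfun_apply f (x n) > t} k) \<le> \<epsilon> / R"
      using H[OF f, unfolded mem_iff] divide_pos_pos[OF \<open>\<epsilon> > 0\<close> \<open>R > 0\<close>] by blast
    have "E i n N f \<le> \<epsilon>" if "n \<notin> B" "i \<in> S" for i n N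
    proof -
      have "E i n N f \<le> (\<Sum>k<N. b i n k * (R * indicat_real {n. blinfun_apply f (x n) > t} k))"
        unfolding E_def using excess nonneg[OF \<open>i \<in> S\<close>] by (intro sum_mono mult_left_mono)
      also have "\<dots> = R * (\<Sum>k<N. b i n k * indicat_real {n. blinfun_apply f (x n) > t} k)"
        by (simp only: sum_distrib_left mult.left_commute[of R])
      also have "\<dots> \<le> R * (\<epsilon> / R)"
        using B(2) that \<open>R > 0\<close> by (intro mult_left_mono) auto
      finally show ?thesis
        using \<open>R > 0\<close> by simp
    qed
    moreover obtain m where "V m \<subseteq> - B"
      using V(3)[of "- B"] B(1) by (auto simp: assoc_filter_def)
    ultimately show ?thesis
      unfolding P_def by blast
  qed
  have K_eq: "K = closure (\<Union>m. weak_star_topology closure_of (convex hull (H \<inter> P \<epsilon> m)))"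
    if "\<epsilon> > 0" for \<epsilon>
    using gen[unfolded I_generates_def, rule_format, of "\<lambda>m. H \<inter> P \<epsilon> m"]
      P_mono[of \<epsilon>] exhaust[OF _ that] by blast
  have hull: "weak_star_topology closure_of (convex hull (H \<inter> P \<epsilon> m)) \<subseteq> P \<epsilon> m" for \<epsilon> m
    by (intro closure_of_minimal P_closed hull_minimal P_convex) auto
  show ?thesis
    unfolding mem_iff
  proof (intro allI impI)
    fix \<eta> :: real
    assume "\<eta> > 0"
    \<comment> \<open>The budget \<open>(s - t) * \<eta>\<close> is halved: one \<epsilon> is for
      the excess sum of an approximant \<open>h\<close> of \<open>g\<close>, the other for the error
      \<open>\<delta> * C\<close> per entry, summed over a row. The term
      \<open>\<bar>M\<bar> + 1\<close> is a positive bound on the row sums whatever the sign of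
      \<open>M\<close>.\<close>
    define \<epsilon> where "\<epsilon> = (s - t) * \<eta> / 2"
    define \<delta> where "\<delta> = \<epsilon> / (C * (\<bar>M\<bar> + 1))"
    have "\<epsilon> > 0"
      using \<open>\<eta> > 0\<close> \<open>s > t\<close> by (simp add: \<epsilon>_def)
    then have "\<delta> > 0"
      using C(1) by (simp add: \<delta>_def)
    have "C * (\<bar>M\<bar> + 1) \<noteq> 0"
      using C(1) by (simp add: add_nonneg_eq_0_iff)
    then have \<delta>_\<epsilon>: "\<delta> * C * (\<bar>M\<bar> + 1) = \<epsilon>"
      by (metis \<delta>_def mult.assoc nonzero_eq_divide_eq)
    have "g \<in> closure (\<Union>m. P \<epsilon> m)"
      using g K_eq[OF \<open>\<epsilon> > 0\<close>] hull[of \<epsilon>]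
        closure_mono[of "\<Union>m. weak_star_topology closure_of (convex hull (H \<inter> P \<epsilon> m))" "\<Union>m. P \<epsilon> m"]
      by blast
    then obtain h m where h: "h \<in> P \<epsilon> m" "dist h g < \<delta>"
      using \<open>\<delta> > 0\<close> unfolding closure_approachable by blast
    obtain B where B: "B \<in> I" "V m = - B"
      using V(2)[of m] by (auto simp: assoc_filter_def)
    have close: "blinfun_apply g (x k) \<le> blinfun_apply h (x k) + \<delta> * C" for k
    proof -
      have "norm (blinfun_apply (g - h) (x k)) \<le> norm (g - h) * norm (x k)"
        by (rule norm_blinfun)
      also have "\<dots> \<le> \<delta> * C"
        using h(2) C \<open>\<delta> > 0\<close> by (intro mult_mono) (auto simp: dist_norm norm_minus_commute)
      finally show ?thesis
        by (simp add: blinfun.diff_left)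
    qed
    have "(\<Sum>k<N. b i n k * indicat_real {n. blinfun_apply g (x n) > s} k) \<le> \<eta>"
      if n: "n \<notin> A \<union> B" and i: "i \<in> S" for n i N
    proof -
      have "(s - t) * (\<Sum>k<N. b i n k * indicat_real {n. blinfun_apply g (x n) > s} k)
          = (\<Sum>k<N. b i n k * ((s - t) * indicat_real {n. blinfun_apply g (x n) > s} k))"
        by (simp only: sum_distrib_left mult.left_commute[of "s - t"])
      \<comment> \<open>Markov's inequality, termwise: \<open>g (x k) > s\<close> forces
        \<open>h (x k) - t > s - t - \<delta> * C\<close>; elsewhere the indicator vanishes.\<close>
      also have "\<dots> \<le> (\<Sum>k<N. b i n k * (max 0 (blinfun_apply h (x k) - t) + \<delta> * C))"
      proof (intro sum_mono mult_left_mono nonneg i)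
        fix k
        show "(s - t) * indicat_real {n. blinfun_apply g (x n) > s} k
            \<le> max 0 (blinfun_apply h (x k) - t) + \<delta> * C"
          using close[of k] mult_pos_pos[OF \<open>\<delta> > 0\<close> C(1)] by (auto simp: indicator_def)
      qed
      also have "\<dots> = E i n N h + \<delta> * C * (\<Sum>k<N. b i n k)"
        by (simp add: E_def distrib_left sum.distrib sum_distrib_left mult_ac)
      also have "\<dots> \<le> \<epsilon> + \<delta> * C * (\<bar>M\<bar> + 1)"
      proof (intro add_mono mult_left_mono)
        show "E i n N h \<le> \<epsilon>"
          using h(1) n i B(2) by (auto simp: P_def)
        show "(\<Sum>k<N. b i n k) \<le> \<bar>M\<bar> + 1"
          using rows(2)[of n i N] n i by auto
        show "0 \<le> \<delta> * C"
          using C(1) \<open>\<delta> > 0\<close> by simp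
      qed
      also have "\<dots> = (s - t) * \<eta>"
        unfolding \<delta>_\<epsilon> by (simp add: \<epsilon>_def)
      finally show ?thesis
        using \<open>s > t\<close> by (simp add: mult_le_cancel_left)
    qed
    \<comment> \<open>Off \<open>A\<close> the row sums are bounded; off \<open>B\<close>, that is
      on \<open>V m\<close>, the excess sums of \<open>h\<close> are.\<close>
    moreover have "A \<union> B \<in> I"
      using I rows(1) B(1) by (auto simp: nat_ideal_def)
    ultimately show "\<exists>A\<in>I. \<forall>n\<in>- A. \<forall>i\<in>S. \<forall>N.
        (\<Sum>k<N. b i n k * indicat_real {n. blinfun_apply g (x n) > s} k) \<le> \<eta>"
      by blast
  qed
qed

section \<open>Comparison of the two suprema\<close>

theorem theorem6p2:
  fixes K H :: "('a::banach \<Rightarrow>\<^sub>L real) set"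
    and I :: "nat set set"
    and S :: "'i set"
    and b :: "'i \<Rightarrow> nat \<Rightarrow> nat \<Rightarrow> real"
    and x :: "nat \<Rightarrow> 'a"
  assumes "convex K"
    and "compactin weak_star_topology K"
    and "H \<subseteq> K"
    and "I_generates H K"
    and "nat_ideal I"
    and "has_countable_base (assoc_filter I)"
    and "S \<noteq> {}"
    and "\<And>i n k. i \<in> S \<Longrightarrow> b i n k \<ge> 0"
    and "\<exists>i\<^sub>0\<in>S. (INF n. \<Sum>k. ennreal (b i\<^sub>0 n k)) > 0"
    and "\<exists>A\<in>I. (SUP (n, i)\<in>(- A) \<times> S. \<Sum>k. ennreal (b i n k)) < \<infinity>"
    and "bounded (range x)"
  shows "(SUP f\<in>H. ideal_limsup (matrix_ideal S b I) (\<lambda>n. blinfun_apply f (x n)))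
       = (SUP f\<in>K. ideal_limsup (matrix_ideal S b I) (\<lambda>n. blinfun_apply f (x n)))"
proof (rule antisym)
  let ?L = "\<lambda>f. ideal_limsup (matrix_ideal S b I) (\<lambda>n. blinfun_apply f (x n))"
  show "(SUP f\<in>H. ?L f) \<le> (SUP f\<in>K. ?L f)"
    using assms(3) by (rule SUP_subset_mono) simp
  obtain A where A: "A \<in> I" "(SUP (n, i)\<in>(- A) \<times> S. \<Sum>k. ennreal (b i n k)) < \<infinity>"
    using assms(10) by blast
  then obtain M where M: "M \<ge> 0" "(SUP (n, i)\<in>(- A) \<times> S. \<Sum>k. ennreal (b i n k)) = ennreal M"
    by (cases "SUP (n, i)\<in>(- A) \<times> S. \<Sum>k. ennreal (b i n k)") auto
  have rows: "(\<Sum>k<N. b i n k) \<le> M" if "n \<notin> A" "i \<in> S" for n i N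
  proof -
    \<comment> \<open>Pairs of row and matrix serve as a single index, so the partial-sum criterion
      applies to all rows outside \<open>A\<close> at once.\<close>
    have "(SUP p\<in>(- A) \<times> S. \<Sum>k. ennreal (b (snd p) (fst p) k)) \<le> ennreal M"
      using M(2) by (simp add: case_prod_beta')
    then have "\<forall>p\<in>(- A) \<times> S. \<forall>N. (\<Sum>k<N. b (snd p) (fst p) k) \<le> M"
      by (subst (asm) SUP_suminf_ennreal_le_iff) (use M(1) assms(8) in auto)
    then show ?thesis
      using that by fastforce
  qed
  show "(SUP f\<in>K. ?L f) \<le> (SUP f\<in>H. ?L f)"
  proof (rule ccontr)
    assume "\<not> ?thesis"
    then obtain t where t: "(SUP f\<in>H. ?L f) < ereal t" "ereal t < (SUP f\<in>K. ?L f)"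
      using ereal_dense2 by (meson not_le)
    have "{n. blinfun_apply f (x n) > t} \<in> matrix_ideal S b I" if "f \<in> H" for f
    proof (rule ccontr)
      assume "{n. blinfun_apply f (x n) > t} \<notin> matrix_ideal S b I"
      then have "ereal t \<le> ?L f"
        unfolding ideal_limsup_def by (intro Sup_upper) blast
      also have "\<dots> \<le> (SUP f\<in>H. ?L f)"
        using that by (rule SUP_upper)
      finally show False
        using t(1) by simp
    qed
    \<comment> \<open>The limsup is a supremum of thresholds, so exceeding \<open>t\<close> yields a
      threshold \<open>s\<close> strictly above \<open>t\<close>: the gap that Markov's inequality
      divides by.\<close>
    moreover obtain g s where "g \<in> K" "t < s"
      "{n. blinfun_apply g (x n) > s} \<notin> matrix_ideal S b I"
      using t(2) by (auto simp: less_SUP_iff ideal_limsup_def less_Sup_iff)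
    ultimately show False
      using generated_superlevel_mem_matrix_ideal[of H K I S b A M x t g s] assms(4-6,8,11) A(1) rows
      by blast
  qed
qed

end
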